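(* A pre-Wajsberg algebra is a Wajsberg algebra if and only if its relation $\le$ is antisymmetric.
   Context: A BE algebra is an algebra $(X,\to,1)$ of type $(2,0)$ such that for all $x,y,z\in X$: $x\to x=1$; $x\to 1=1$; $1\to x=x$; $x\to (y\to z)=y\to (x\to z)$. Write $x\le y$ iff $x\to y=1$. It is bounded if there is $0\in X$ with $0\le x$ for all $x\in X$; then $x^*:=x\to 0$. It is involutive if it is bounded and $x^{**}=x$ for all $x\in X$; an involutive BE algebra is denoted $(X,\to,^*,1)$. In an involutive BE algebra define $x\Cap y=((x^*\to y^* )\to y^* )^*$. A pre-Wajsberg algebra is an involutive BE algebra satisfying $x\to (x\Cap y)=x\to y$ for all $x,y$. A Wajsberg algebra is an algebra $(X,\to,^*,1)$ of type $(2,1,0)$ such that for all $x,y,z\in X$: $1\to x=x$; $(y\to z)\to ((z\to x)\to (y\to x))=1$; $(x\to y)\to y=(y\to x)\to x$; $(x^*\to y^* )\to (y\to x)=1$. *)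

theory Defs
  imports Main
begin

text \<open>
  An algebra is given by a carrier set together with operations on the ambient type.  The operations
  are constrained only on the carrier, which they are required to preserve; every carrier is nonempty
  because it contains the constant.
\<close>

definition be_le :: "('a \<Rightarrow> 'a \<Rightarrow> 'a) \<Rightarrow> 'a \<Rightarrow> 'a \<Rightarrow> 'a \<Rightarrow> bool" where
  "be_le imp e x y \<longleftrightarrow> imp x y = e"

locale be_algebra =
  fixes X :: "'a set"
    and imp :: "'a \<Rightarrow> 'a \<Rightarrow> 'a"  (infixr "\<rightarrow>" 60)
    and e :: 'a  ("\<one>")
  assumes imp_closed: "\<lbrakk>x \<in> X; y \<in> X\<rbrakk> \<Longrightarrow> x \<rightarrow> y \<in> X"
    and one_closed: "\<one> \<in> X"
    and imp_self: "x \<in> X \<Longrightarrow> x \<rightarrow> x = \<one>"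
    and imp_one: "x \<in> X \<Longrightarrow> x \<rightarrow> \<one> = \<one>"
    and one_imp: "x \<in> X \<Longrightarrow> \<one> \<rightarrow> x = x"
    and exchange: "\<lbrakk>x \<in> X; y \<in> X; z \<in> X\<rbrakk> \<Longrightarrow> x \<rightarrow> (y \<rightarrow> z) = y \<rightarrow> (x \<rightarrow> z)"

text \<open>
  The complement is part of the signature.  Its values on the carrier are determined: involutivity
  forces the bottom element to be unique, since any bottom element \<open>w\<close> then satisfies
  \<open>w = star (star w) = (w \<rightarrow> z) \<rightarrow> z = \<one> \<rightarrow> z = z\<close>.
\<close>

locale involutive_be_algebra = be_algebra X imp e
  for X :: "'a set"
    and imp :: "'a \<Rightarrow> 'a \<Rightarrow> 'a"  (infixr "\<rightarrow>" 60)
    and star :: "'a \<Rightarrow> 'a"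
    and e :: 'a  ("\<one>") +
  assumes bounded: "\<exists>z\<in>X. (\<forall>x\<in>X. be_le imp \<one> z x) \<and> (\<forall>x\<in>X. star x = x \<rightarrow> z)"
    and involutive: "x \<in> X \<Longrightarrow> star (star x) = x"

definition be_cap :: "('a \<Rightarrow> 'a \<Rightarrow> 'a) \<Rightarrow> ('a \<Rightarrow> 'a) \<Rightarrow> 'a \<Rightarrow> 'a \<Rightarrow> 'a" where
  "be_cap imp star x y = star (imp (imp (star x) (star y)) (star y))"

locale pre_wajsberg_algebra = involutive_be_algebra +
  assumes imp_cap: "\<lbrakk>x \<in> X; y \<in> X\<rbrakk> \<Longrightarrow> imp x (be_cap imp star x y) = imp x y"

locale wajsberg_algebra =
  fixes X :: "'a set"
    and imp :: "'a \<Rightarrow> 'a \<Rightarrow> 'a"  (infixr "\<rightarrow>" 60)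
    and star :: "'a \<Rightarrow> 'a"
    and e :: 'a  ("\<one>")
  assumes imp_closed: "\<lbrakk>x \<in> X; y \<in> X\<rbrakk> \<Longrightarrow> x \<rightarrow> y \<in> X"
    and star_closed: "x \<in> X \<Longrightarrow> star x \<in> X"
    and one_closed: "\<one> \<in> X"
    and one_imp: "x \<in> X \<Longrightarrow> \<one> \<rightarrow> x = x"
    and imp_trans: "\<lbrakk>x \<in> X; y \<in> X; z \<in> X\<rbrakk> \<Longrightarrow> (y \<rightarrow> z) \<rightarrow> ((z \<rightarrow> x) \<rightarrow> (y \<rightarrow> x)) = \<one>"
    and imp_comm: "\<lbrakk>x \<in> X; y \<in> X\<rbrakk> \<Longrightarrow> (x \<rightarrow> y) \<rightarrow> y = (y \<rightarrow> x) \<rightarrow> x"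
    and contrapos: "\<lbrakk>x \<in> X; y \<in> X\<rbrakk> \<Longrightarrow> (star x \<rightarrow> star y) \<rightarrow> (y \<rightarrow> x) = \<one>"

end

theory Submission
  imports Defs
begin

text \<open>
  Contraposition turns the pre-Wajsberg identity into \<open>((a \<rightarrow> b) \<rightarrow> b) \<rightarrow> a = b \<rightarrow> a\<close>.  With the exchange
  law this gives \<open>(a \<rightarrow> b) \<rightarrow> b \<le> (b \<rightarrow> a) \<rightarrow> a\<close>, so antisymmetry yields commutativity, and the
  remaining Wajsberg axioms follow from commutativity and exchange.
\<close>

context involutive_be_algebra
begin

lemma star_closed: "x \<in> X \<Longrightarrow> star x \<in> X"
  using bounded imp_closed by auto

text \<open>With \<open>star y\<close> written as \<open>y \<rightarrow> z\<close> for the bottom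
  \<open>z\<close>, exchange brings \<open>y\<close> to the front and leaves
  \<open>star (star x)\<close>, which is \<open>x\<close>.\<close>

lemma star_imp_star:
  assumes "x \<in> X" "y \<in> X"
  shows "star x \<rightarrow> star y = y \<rightarrow> x"
proof -
  obtain z where z: "z \<in> X" "\<And>x. x \<in> X \<Longrightarrow> star x = x \<rightarrow> z"
    using bounded by blast
  have "star x \<rightarrow> star y = star x \<rightarrow> (y \<rightarrow> z)"
    using z assms by simp
  also have "\<dots> = y \<rightarrow> (star x \<rightarrow> z)"
    using exchange[OF star_closed] z assms by blast
  also have "\<dots> = y \<rightarrow> star (star x)"
    using z(2)[OF star_closed] assms by simp
  finally show ?thesis
    using involutive assms by simp
qed

end

lemma (in pre_wajsberg_algebra) imp_imp_absorb:
  assumes "a \<in> X" "b \<in> X"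
  shows "imp (imp (imp a b) b) a = imp b a"
proof -
  let ?c = "imp (imp a b) b"
  \<comment> \<open>In \<open>be_cap imp star (star a) (star b)\<close> the double stars cancel,
    leaving exactly \<open>star ?c\<close>.\<close>
  have "imp (star a) (star ?c) = imp (star a) (star b)"
    using imp_cap[of "star a" "star b"] assms by (simp add: be_cap_def involutive star_closed)
  then show ?thesis
    using assms by (simp add: star_imp_star imp_closed)
qed

lemma (in pre_wajsberg_algebra) imp_imp_le:
  assumes "a \<in> X" "b \<in> X"
  shows "be_le imp e (imp (imp a b) b) (imp (imp b a) a)"
proof -
  have "imp (imp (imp a b) b) (imp (imp b a) a) = imp (imp b a) (imp (imp (imp a b) b) a)"
    using assms by (intro exchange) (simp_all add: imp_closed)
  also have "\<dots> = e"
    using assms by (simp add: imp_imp_absorb imp_closed imp_self)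
  finally show ?thesis
    by (simp add: be_le_def)
qed

text \<open>Commutativity between two exchanges turns
  \<open>(z \<rightarrow> x) \<rightarrow> (y \<rightarrow> x)\<close> into
  \<open>(x \<rightarrow> z) \<rightarrow> (y \<rightarrow> z)\<close>, whose conclusion matches the
  premise \<open>y \<rightarrow> z\<close>.\<close>

lemma (in be_algebra) imp_trans_if_imp_comm:
  assumes comm: "\<And>x y. \<lbrakk>x \<in> X; y \<in> X\<rbrakk> \<Longrightarrow> (x \<rightarrow> y) \<rightarrow> y = (y \<rightarrow> x) \<rightarrow> x"
    and "x \<in> X" "y \<in> X" "z \<in> X"
  shows "(y \<rightarrow> z) \<rightarrow> ((z \<rightarrow> x) \<rightarrow> (y \<rightarrow> x)) = \<one>"
proof -
  have "(z \<rightarrow> x) \<rightarrow> (y \<rightarrow> x) = y \<rightarrow> ((z \<rightarrow> x) \<rightarrow> x)"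
    using assms(2-) by (intro exchange) (simp_all add: imp_closed)
  also have "\<dots> = y \<rightarrow> ((x \<rightarrow> z) \<rightarrow> z)"
    using comm[of z x] assms(2-) by simp
  also have "\<dots> = (x \<rightarrow> z) \<rightarrow> (y \<rightarrow> z)"
    using assms(2-) by (intro exchange) (simp_all add: imp_closed)
  finally have "(y \<rightarrow> z) \<rightarrow> ((z \<rightarrow> x) \<rightarrow> (y \<rightarrow> x)) = (y \<rightarrow> z) \<rightarrow> ((x \<rightarrow> z) \<rightarrow> (y \<rightarrow> z))"
    by simp
  also have "\<dots> = (x \<rightarrow> z) \<rightarrow> ((y \<rightarrow> z) \<rightarrow> (y \<rightarrow> z))"
    using assms(2-) by (intro exchange) (simp_all add: imp_closed)
  finally show ?thesis
    using assms(2-) by (simp add: imp_closed imp_self imp_one)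
qed

lemma (in pre_wajsberg_algebra) wajsberg_algebra_if_antisymp:
  assumes "antisymp_on X (be_le imp e)"
  shows "wajsberg_algebra X imp star e"
proof -
  have comm: "imp (imp x y) y = imp (imp y x) x" if "x \<in> X" "y \<in> X" for x y
    using antisymp_onD[OF assms _ _ imp_imp_le imp_imp_le] that by (simp add: imp_closed)
  show ?thesis
    \<comment> \<open>By \<open>star_imp_star\<close>, the contraposition axiom becomes an instance
      of \<open>imp_self\<close>.\<close>
    by unfold_locales
      (simp_all add: imp_closed star_closed one_closed one_imp imp_trans_if_imp_comm comm
        star_imp_star imp_self)
qed

text \<open>If both implications equal \<open>\<one>\<close>, then \<open>imp_comm\<close> reads
  \<open>\<one> \<rightarrow> y = \<one> \<rightarrow> x\<close>.\<close>

lemma (in wajsberg_algebra) antisymp_on_be_le: "antisymp_on X (be_le imp e)"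
  by (rule antisymp_onI) (metis be_le_def imp_comm one_imp)

theorem corollary4p5:
  fixes X :: "'a set"
    and imp :: "'a \<Rightarrow> 'a \<Rightarrow> 'a"
    and star :: "'a \<Rightarrow> 'a"
    and e :: 'a
  assumes "pre_wajsberg_algebra X imp star e"
  shows "wajsberg_algebra X imp star e \<longleftrightarrow> antisymp_on X (be_le imp e)"
  by (rule iffI[OF wajsberg_algebra.antisymp_on_be_le
        pre_wajsberg_algebra.wajsberg_algebra_if_antisymp[OF assms]])

end
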